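(* For $r>0$ small enough and $R$ large enough (depending on $r$), $$H(\overline{\mathcal{P}_{att,j}})\subset\mathcal{P}_{att,j+\nu p}\cup\left(\{0\}\times\mathbb{D}_{r}\right)\qquad\text{for } 1\leq j\leq\nu q.$$ In particular $H(\overline{\mathcal{P}_{att}})\subset\mathcal{P}_{att}\cup(\{0\}\times\mathbb{D}_{r})$, and all points of $\mathcal{P}_{att}$ are attracted to the origin under iterations by $H$.
   Context: Let $H$ be a semi-parabolic germ of holomorphic transformation of $(\mathbb{C}^{2},0)$ with eigenvalues $\lambda=e^{2\pi i p/q}$ ($p/q$ in lowest terms) and $\mu$, $|\mu|<1$, written in local coordinates as $H(x,y)=(x_{1},y_{1})$ with $$x_{1}=\lambda\left(x+x^{\nu q+1}+Cx^{2\nu q+1}+a_{2\nu q+2}(y)x^{2\nu q+2}+\dots\right),\qquad y_{1}=\mu y+xh(x,y),$$ where $\nu\ge1$ is an integer, $C$ is a constant, and $a_{j}$, $h$ are germs of holomorphic functions. Put $m=\nu q$ and $$\Delta_{R}=\left\{x\in\mathbb{C}:\left(\mathrm{Re}(x^{m})+\tfrac{1}{2R}\right)^{2}+\left(|\mathrm{Im}(x^{m})|-\tfrac{1}{2R}\right)^{2}<\tfrac{1}{2R^{2}}\right\}.$$ $\Delta_{R}$ has $m$ connected components $\Delta_{R,j}$, $1\le j\le m$, labeled in counterclockwise cyclic order around $0$ (indices taken modulo $m$). Define $\mathcal{P}_{att}=\{(x,y)\in\mathbb{C}^{2}:x\in\Delta_{R},|y|<r\}$ and $\mathcal{P}_{att,j}=\{(x,y)\in\mathbb{C}^{2}:x\in\Delta_{R,j},|y|<r\}$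 (the big attractive petals). $\mathbb{D}_{r}=\{|y|<r\}$. *)

theory Defs
  imports "HOL-Complex_Analysis.Complex_Analysis"
begin

text \<open>
  Holomorphy in two variables (meant for open sets): the real Frechet derivative exists at every
  point and is complex-linear.
\<close>

definition holomorphic2_on ::
    "(complex \<times> complex \<Rightarrow> complex) \<Rightarrow> (complex \<times> complex) set \<Rightarrow> bool"
  where "holomorphic2_on f U \<longleftrightarrow>
    (\<forall>z\<in>U. \<exists>A B. (f has_derivative (\<lambda>(u, v). A * u + B * v)) (at z))"

definition bidisk :: "real \<Rightarrow> (complex \<times> complex) set"
  where "bidisk \<rho> = ball 0 \<rho> \<times> ball 0 \<rho>"

definition Delta :: "nat \<Rightarrow> real \<Rightarrow> complex set"
  where "Delta m R = {x. (Re (x ^ m) + 1 / (2 * R))\<^sup>2 + (\<bar>Im (x ^ m)\<bar> - 1 / (2 * R))\<^sup>2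
                          < 1 / (2 * R\<^sup>2)}"

definition petal :: "real \<Rightarrow> complex set \<Rightarrow> (complex \<times> complex) set"
  where "petal r A = {(x, y). x \<in> A \<and> norm y < r}"

text \<open>
  \<open>D\<close> labels the \<open>m\<close> connected components of \<open>S\<close>, with indices taken modulo \<open>m\<close>, in counterclockwise
  cyclic order around the origin: \<open>\<theta> j\<close> is the argument of some point of \<open>D j\<close>, and these arguments
  increase with \<open>j\<close>, by exactly one full turn each time \<open>j\<close> runs through \<open>m\<close> consecutive indices.
  The component that receives the label 1 is left arbitrary. Since the components of \<open>Delta m R\<close> lie
  in disjoint sectors, it does not matter which points of the components are used.
\<close>

definition ccw_labelling :: "nat \<Rightarrow> complex set \<Rightarrow> (int \<Rightarrow> complex set) \<Rightarrow> bool"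
  where "ccw_labelling m S D \<longleftrightarrow>
    bij_betw D {1..int m} (components S) \<and>
    (\<forall>j. D (j + int m) = D j) \<and>
    (\<exists>\<theta>::int \<Rightarrow> real. strict_mono \<theta> \<and> (\<forall>j. \<theta> (j + int m) = \<theta> j + 2 * pi) \<and>
       (\<forall>j. \<exists>t>0. of_real t * cis (\<theta> j) \<in> D j))"

text \<open>Such a labelling of the components of \<open>Delta m R\<close> exists, so in particular there are exactly
  \<open>m\<close> of them. In the coordinate \<open>log x\<close>, membership in \<open>Delta m R\<close> reads as follows.\<close>

lemma exp_in_Delta_iff:
  assumes "R > 0"
  shows "exp z \<in> Delta m R \<longleftrightarrow>
           exp (real m * Re z) < (\<bar>sin (real m * Im z)\<bar> - cos (real m * Im z)) / R"
proof -
  define T \<phi> h where "T = exp (real m * Re z)" and "\<phi> = real m * Im z" and "h = 1 / (2 * R)"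
  have "exp z ^ m = exp (of_nat m * z)"
    by (simp add: exp_of_nat_mult)
  then have ReIm: "Re (exp z ^ m) = T * cos \<phi>" "Im (exp z ^ m) = T * sin \<phi>"
    by (simp_all add: Re_exp Im_exp T_def \<phi>_def)
  have T: "T > 0" by (simp add: T_def)
  have abs: "\<bar>T * sin \<phi>\<bar> = T * \<bar>sin \<phi>\<bar>" using T by (simp add: abs_mult)
  have h2: "1 / (2 * R\<^sup>2) = 2 * h\<^sup>2"
    by (simp add: h_def power2_eq_square)
  have "exp z \<in> Delta m R \<longleftrightarrow>
      (T * cos \<phi> + h)\<^sup>2 + (T * \<bar>sin \<phi>\<bar> - h)\<^sup>2 < 2 * h\<^sup>2"
    unfolding Delta_def mem_Collect_eq ReIm abs h2 by (simp add: h_def)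
  also have "(T * cos \<phi> + h)\<^sup>2 + (T * \<bar>sin \<phi>\<bar> - h)\<^sup>2 =
      T\<^sup>2 * (\<bar>sin \<phi>\<bar>\<^sup>2 + (cos \<phi>)\<^sup>2) + 2 * h * T * (cos \<phi> - \<bar>sin \<phi>\<bar>) + 2 * h\<^sup>2"
    by (simp only: power2_eq_square) algebra
  also have "\<dots> = T * (T - (\<bar>sin \<phi>\<bar> - cos \<phi>) / R) + 2 * h\<^sup>2"
    using assms by (simp add: h_def field_simps power2_eq_square)
  finally show ?thesis
    using T by (simp add: mult_less_0_iff T_def \<phi>_def)
qed

lemma abs_sin_gt_cos_iff:
  fixes \<phi> :: real
  assumes "0 < \<phi>" "\<phi> < 2 * pi"
  shows "cos \<phi> < \<bar>sin \<phi>\<bar> \<longleftrightarrow> pi / 4 < \<phi> \<and> \<phi> < 7 * pi / 4"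
proof -
  define \<psi> where "\<psi> = \<bar>\<phi> - pi\<bar>"
  have \<psi>: "0 \<le> \<psi>" "\<psi> < pi" using assms by (auto simp: \<psi>_def)
  have c: "cos \<phi> = - cos \<psi>"
    by (simp add: \<psi>_def)
  have "\<bar>sin \<phi>\<bar> = \<bar>sin \<psi>\<bar>"
    by (simp add: \<psi>_def abs_if)
  also have "\<dots> = sin \<psi>" using \<psi> by (simp add: sin_ge_zero)
  finally have s: "\<bar>sin \<phi>\<bar> = sin \<psi>" .
  have "cos (\<psi> - pi / 4) = (cos \<psi> + sin \<psi>) * (sqrt 2 / 2)"
    by (simp add: cos_diff cos_45 sin_45 algebra_simps)
  then have "cos (\<psi> - pi / 4) > 0 \<longleftrightarrow> cos \<psi> + sin \<psi> > 0"
    by (simp only: zero_less_mult_iff) simp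
  then have "cos \<phi> < \<bar>sin \<phi>\<bar> \<longleftrightarrow> cos (\<psi> - pi / 4) > 0"
    unfolding c s by linarith
  also have "\<dots> \<longleftrightarrow> \<psi> < 3 * pi / 4"
  proof
    assume "\<psi> < 3 * pi / 4"
    then show "cos (\<psi> - pi / 4) > 0"
      using \<psi> by (intro cos_gt_zero_pi) auto
  next
    assume *: "cos (\<psi> - pi / 4) > 0"
    show "\<psi> < 3 * pi / 4"
    proof (rule ccontr)
      assume "\<not> \<psi> < 3 * pi / 4"
      then have "cos (\<psi> - pi / 4) \<le> cos (pi / 2)"
        using \<psi> by (intro cos_monotone_0_pi_le) auto
      with * show False by simp
    qed
  qed
  also have "\<dots> \<longleftrightarrow> pi / 4 < \<phi> \<and> \<phi> < 7 * pi / 4"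
    by (auto simp: \<psi>_def abs_if)
  finally show ?thesis .
qed

lemma ccw_labelling_Delta_exists:
  assumes m: "m \<ge> 1" and R: "R > 0"
  shows "\<exists>D. ccw_labelling m (Delta m R) D"
proof -
  define g where "g \<theta> = (\<bar>sin (real m * \<theta>)\<bar> - cos (real m * \<theta>)) / R" for \<theta>
  define \<alpha> where "\<alpha> j = (2 * pi * of_int j) / real m" for j :: int
  define L where "L j = {z. \<alpha> j < Im z \<and> Im z < \<alpha> (j + 1) \<and> exp (real m * Re z) < g (Im z)}" for j
  define D where "D j = exp ` L j" for j
  have m0: "real m > 0" using m by simp
  have mem: "exp z \<in> Delta m R \<longleftrightarrow> exp (real m * Re z) < g (Im z)" for z
    using exp_in_Delta_iff[OF R] by (simp add: g_def)
  have zero: "0 \<notin> Delta m R"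
    using m R by (simp add: Delta_def power2_eq_square power_0_left)
  have \<alpha>_less: "\<alpha> i < \<alpha> j \<longleftrightarrow> i < j" for i j
    using m0 by (simp add: \<alpha>_def divide_less_cancel)
  have \<alpha>_le: "\<alpha> i \<le> \<alpha> j \<longleftrightarrow> i \<le> j" for i j
    using \<alpha>_less[of j i] by linarith
  have \<alpha>_add: "\<alpha> (j + int m * k) = \<alpha> j + 2 * pi * of_int k" for j k
    using m0 by (simp add: \<alpha>_def field_simps)
  have \<alpha>_add1: "\<alpha> (j + 1) = \<alpha> j + 2 * pi / real m" for j
    by (simp add: \<alpha>_def field_simps add_divide_distrib)
  have m_cases: "real m * \<theta> = 2 * pi * of_int j + (real m * (\<theta> - \<alpha> j))" for \<theta> j
    using m0 by (simp add: \<alpha>_def field_simps)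
  have trig: "sin (2 * pi * of_int j + x) = sin x" "cos (2 * pi * of_int j + x) = cos x"
    for x and j :: int
    by (simp_all add: sin_add cos_add)
  have g_pos: "g \<theta> > 0 \<longleftrightarrow> pi / 4 < real m * (\<theta> - \<alpha> j) \<and> real m * (\<theta> - \<alpha> j) < 7 * pi / 4"
    if "\<alpha> j < \<theta>" "\<theta> < \<alpha> (j + 1)" for \<theta> j
  proof -
    have "0 < real m * (\<theta> - \<alpha> j)" "real m * (\<theta> - \<alpha> j) < 2 * pi"
      using that m0 unfolding \<alpha>_add1 by (simp_all add: field_simps)
    from abs_sin_gt_cos_iff[OF this] show ?thesis
      using R unfolding g_def by (subst (1 2) m_cases[of _ j]) (simp add: trig zero_less_divide_iff)
  qed
  have g_per: "g (\<theta> + 2 * pi * of_int k) = g \<theta>" for \<theta> k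
  proof -
    have "real m * (\<theta> + 2 * pi * of_int k) = 2 * pi * of_int (int m * k) + real m * \<theta>"
      by (simp add: algebra_simps)
    then show ?thesis unfolding g_def by (simp only: trig)
  qed
  have g_\<alpha>: "g (\<alpha> j) < 0" for j
    using m_cases[of "\<alpha> j" j] trig[of j 0] R unfolding g_def by simp
  have g_cont: "continuous_on A g" for A
    unfolding g_def by (intro continuous_intros) (use R in auto)

  define \<theta> where "\<theta> j = \<alpha> j + pi / real m" for j
  have \<theta>_in: "\<alpha> j < \<theta> j" "\<theta> j < \<alpha> (j + 1)" for j
    using m0 unfolding \<theta>_def \<alpha>_add1 by (simp_all add: field_simps)
  have g\<theta>: "g (\<theta> j) > 0" for j
    using m0 by (subst g_pos[OF \<theta>_in]) (simp add: \<theta>_def)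
  have ray: "Complex (ln (g (\<theta> j) / 2) / real m) (\<theta> j) \<in> L j" for j
    using \<theta>_in[of j] g\<theta>[of j] m0 by (simp add: L_def)

  have openD: "open (D j)" for j
  proof -
    have "open (L j)"
      unfolding L_def
      by (intro open_Collect_conj open_Collect_less continuous_intros
            continuous_on_compose2[OF g_cont]) auto
    moreover have "inj_on exp (L j)"
    proof (rule inj_onI, rule exp_complex_eqI)
      fix w z assume "w \<in> L j" "z \<in> L j"
      then have "\<bar>Im w - Im z\<bar> < 2 * pi / real m"
        unfolding L_def \<alpha>_add1 by auto
      also have "\<dots> \<le> 2 * pi" using m by (simp add: field_simps)
      finally show "\<bar>Im w - Im z\<bar> < 2 * pi" .
    qed
    ultimately show ?thesis
      unfolding D_def by (intro open_mapping_thm3 holomorphic_intros)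
  qed
  have connD: "connected (D j)" for j
  proof -
    define I where "I = {\<alpha> j + pi / 4 / real m <..< \<alpha> j + 7 * pi / 4 / real m}"
    define f where "f p = Complex ((ln (g (snd p)) + fst p) / real m) (snd p)" for p
    have I: "\<theta> \<in> I \<longleftrightarrow> \<alpha> j < \<theta> \<and> \<theta> < \<alpha> (j + 1) \<and> g \<theta> > 0" for \<theta>
    proof -
      have *: "\<theta> \<in> I \<longleftrightarrow> pi / 4 < real m * (\<theta> - \<alpha> j) \<and> real m * (\<theta> - \<alpha> j) < 7 * pi / 4"
        using m0 by (simp add: I_def field_simps)
      have "\<theta> \<in> I \<Longrightarrow> \<alpha> j < \<theta> \<and> \<theta> < \<alpha> (j + 1)"
      proof -
        assume "\<theta> \<in> I"
        then have "0 < real m * (\<theta> - \<alpha> j)" "real m * (\<theta> - \<alpha> j) < 2 * pi"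
          unfolding * using pi_gt_zero by linarith+
        then show ?thesis
          using m0 unfolding \<alpha>_add1 by (simp add: zero_less_mult_iff field_simps)
      qed
      with g_pos[of j \<theta>] * show ?thesis by blast
    qed
    have "L j = f ` ({..<0} \<times> I)"
    proof (intro equalityI subsetI)
      fix z assume z: "z \<in> L j"
      then have gz: "g (Im z) > 0"
        by (auto simp: L_def intro: less_trans[OF exp_gt_zero])
      have "real m * Re z < ln (g (Im z))"
        using z gz exp_less_cancel_iff[of "real m * Re z" "ln (g (Im z))"] by (simp add: L_def)
      moreover have "z = f (real m * Re z - ln (g (Im z)), Im z)"
        using m0 by (simp add: f_def complex_eq_iff)
      moreover have "Im z \<in> I" using z gz by (simp add: I L_def)
      ultimately show "z \<in> f ` ({..<0} \<times> I)" by (intro image_eqI) auto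
    next
      fix z assume "z \<in> f ` ({..<0} \<times> I)"
      then obtain u t where ut: "u < 0" "t \<in> I" "z = f (u, t)" by auto
      then have "exp (ln (g t) + u) < g t"
        using I[of t] by (simp add: exp_add)
      then show "z \<in> L j" using ut I[of t] m0 by (simp add: L_def f_def)
    qed
    moreover have "connected ({..<0::real} \<times> I)"
      unfolding I_def by (intro connected_Times) auto
    moreover have "continuous_on ({..<0::real} \<times> I) f"
      unfolding f_def Complex_eq
      by (intro continuous_intros continuous_on_compose2[OF g_cont]) (use I m0 in force)+
    ultimately have "connected (L j)" by (simp add: connected_continuous_image)
    then show ?thesis
      unfolding D_def by (intro connected_continuous_image continuous_intros)
  qed
  have neD: "D j \<noteq> {}" for j
    using ray[of j] by (auto simp: D_def)
  have overlap: "\<exists>k. i = j + int m * k" if "D i \<inter> D j \<noteq> {}" for i j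
  proof -
    from that obtain w z where wz: "w \<in> L i" "z \<in> L j" "exp w = exp z"
      by (auto simp: D_def)
    then obtain n :: int where "w = z + (of_int (2 * n) * pi) * \<i>"
      using exp_eq by blast
    then have Im: "Im w = Im z + 2 * pi * of_int n" by simp
    have "\<alpha> i < \<alpha> (j + int m * n + 1)" "\<alpha> (j + int m * n) < \<alpha> (i + 1)"
      using wz(1,2) Im \<alpha>_add[of j n] \<alpha>_add[of "j + 1" n] by (auto simp: L_def algebra_simps)
    then have "i = j + int m * n" unfolding \<alpha>_less by linarith
    then show ?thesis by blast
  qed
  have perD: "D (j + int m * k) = D j" for j k
  proof -
    have sub: "D j \<subseteq> D (j + int m * k)" for j k
    proof
      fix x assume "x \<in> D j"
      then obtain z where z: "z \<in> L j" "x = exp z" by (auto simp: D_def)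
      define w where "w = z + (of_int (2 * k) * pi) * \<i>"
      have "exp w = exp z" unfolding exp_eq w_def by blast
      moreover have "w \<in> L (j + int m * k)"
        using z(1) \<alpha>_add[of j k] \<alpha>_add[of "j + 1" k] g_per[of "Im z" k]
        by (simp add: L_def w_def algebra_simps)
      ultimately show "x \<in> D (j + int m * k)" using z(2) by (metis D_def imageI)
    qed
    from sub[of j k] sub[of "j + int m * k" "-k"] show ?thesis by simp
  qed
  have inj: "inj_on D {1..int m}"
  proof (rule inj_onI)
    fix i j assume ij: "i \<in> {1..int m}" "j \<in> {1..int m}" "D i = D j"
    then obtain k where k: "i = j + int m * k" using overlap[of i j] neD by auto
    then have "int m * k < int m * 1" "int m * (-1) < int m * k"
      using ij(1,2) unfolding atLeastAtMost_iff by linarith+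
    moreover have "0 < int m" using m by simp
    ultimately have "k < 1" "-1 < k" using mult_less_cancel_left_pos by blast+
    then show "i = j" using k by simp
  qed
  have Un: "\<Union> (D ` {1..int m}) = Delta m R"
  proof (intro equalityI subsetI)
    fix x assume "x \<in> \<Union> (D ` {1..int m})"
    then show "x \<in> Delta m R" by (auto simp: D_def mem L_def)
  next
    fix x assume x: "x \<in> Delta m R"
    with zero have "x \<noteq> 0" by auto
    then have Lnx: "exp (Ln x) = x" by simp
    define t where "t = Im (Ln x)"
    define k where "k = \<lfloor>real m * t / (2 * pi)\<rfloor>"
    have gt: "exp (real m * Re (Ln x)) < g t"
      using x mem[of "Ln x"] Lnx by (simp add: t_def)
    then have "g t > 0" by (rule less_trans[OF exp_gt_zero])
    with g_\<alpha>[of k] have "t \<noteq> \<alpha> k" by auto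
    moreover have "\<alpha> k \<le> t" "t < \<alpha> (k + 1)"
    proof -
      have "of_int k \<le> real m * t / (2 * pi)" "real m * t / (2 * pi) < of_int (k + 1)"
        unfolding k_def by linarith+
      then show "\<alpha> k \<le> t" "t < \<alpha> (k + 1)"
        using m0 by (simp_all add: \<alpha>_def field_simps)
    qed
    ultimately have "Ln x \<in> L k" using gt by (simp add: L_def t_def)
    then have "x \<in> D k" unfolding D_def using Lnx by force
    moreover define i where "i = (k - 1) mod int m + 1"
    have "k = i + int m * ((k - 1) div int m)" by (simp add: i_def)
    then have "D k = D i" by (metis perD)
    moreover have "i \<in> {1..int m}"
    proof -
      have "(k - 1) mod int m < int m" "0 \<le> (k - 1) mod int m" using m by simp_all
      then show ?thesis unfolding i_def atLeastAtMost_iff by linarith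
    qed
    ultimately show "x \<in> \<Union> (D ` {1..int m})" by blast
  qed
  have comp: "components (Delta m R) = D ` {1..int m}"
  proof (rule components_open_unique[OF _ Un])
    show "pairwise disjnt (D ` {1..int m})"
    proof (rule pairwiseI)
      fix A B assume "A \<in> D ` {1..int m}" "B \<in> D ` {1..int m}" "A \<noteq> B"
      then obtain i j where ij: "A = D i" "B = D j" "D i \<noteq> D j" by blast
      then show "disjnt A B" using overlap[of i j] perD unfolding disjnt_def by metis
    qed
  qed (use openD connD neD in blast)
  have "ccw_labelling m (Delta m R) D"
    unfolding ccw_labelling_def
  proof (intro conjI exI[of _ \<theta>] allI)
    show "bij_betw D {1..int m} (components (Delta m R))"
      using inj comp by (simp add: bij_betw_def)
    show "D (j + int m) = D j" for j using perD[of j 1] by simp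
    show "strict_mono \<theta>" by (auto simp: strict_mono_def \<theta>_def \<alpha>_less)
    show "\<theta> (j + int m) = \<theta> j + 2 * pi" for j using \<alpha>_add[of j 1] by (simp add: \<theta>_def)
    show "\<exists>t>0. of_real t * cis (\<theta> j) \<in> D j" for j
    proof (intro exI conjI)
      let ?z = "Complex (ln (g (\<theta> j) / 2) / real m) (\<theta> j)"
      show "exp (Re ?z) > 0" by simp
      have "exp ?z = of_real (exp (Re ?z)) * cis (\<theta> j)"
        by (subst exp_eq_polar) simp
      then show "of_real (exp (Re ?z)) * cis (\<theta> j) \<in> D j"
        using ray[of j] unfolding D_def by (metis imageI)
    qed
  qed
  then show ?thesis by blast
qed

end

theory Submission
  imports Defs
begin

text \<open>
  In the coordinate \<open>Z = - 1 / x ^ m\<close> the set \<open>Delta m R\<close> is \<open>Re Z + \<bar>Im Z\<bar> > R\<close>, and the first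
  component of \<open>H\<close> acts as \<open>Z \<mapsto> Z + m + o(1)\<close> for \<open>R \<rightarrow> \<infinity>\<close>, uniformly in \<open>y\<close>. Since the error
  is eventually less than \<open>1/2\<close>, this gives invariance, and \<open>Re Z\<close> grows by at least \<open>1/2\<close> at each
  step, so \<open>x \<rightarrow> 0\<close>; the second coordinate then follows by contraction. As \<open>x\<^sub>1 / (lam x)\<close> is close
  to \<open>1\<close>, the components are permuted as by the rotation \<open>lam\<close>. They are told apart by a locally
  constant function with values in the \<open>m\<close>-th roots of \<open>-1\<close>.
\<close>

section \<open>Analytic preliminaries: power series tails and perturbed contractions\<close>

lemma holomorphic2_on_imp_continuous_on:
  assumes "holomorphic2_on f U"
  shows "continuous_on U f"
  using assms has_derivative_continuous
  unfolding holomorphic2_on_def by (blast intro: continuous_at_imp_continuous_on)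

text \<open>An argument of Schwarz type: dividing out \<open>x ^ N\<close> leaves a holomorphic
  function, which the maximum principle bounds on the disk by its size \<open>B / s ^ N\<close> on
  the circle. The constant depends on \<open>f\<close> only through \<open>B\<close>, which later
  makes the bound uniform in \<open>y\<close>.\<close>

lemma norm_power_series_tail_le:
  fixes c :: "nat \<Rightarrow> complex"
  assumes s: "0 < s" "s < \<rho>"
    and sums: "\<And>x. norm x < \<rho> \<Longrightarrow> (\<lambda>k. c k * x ^ (N + k)) sums f x"
    and bound: "\<And>x. norm x = s \<Longrightarrow> norm (f x) \<le> B"
    and x: "norm x \<le> s"
  shows "norm (f x) \<le> B / s ^ N * norm x ^ N"
proof -
  \<comment> \<open>At 0 the quotient gets the value that makes \<open>g\<close> the sum of the
    series with coefficients \<open>c k\<close>.\<close>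
  define g where "g x = (if x = 0 then c 0 else f x / x ^ N)" for x
  \<comment> \<open>The factor \<open>0 ^ N\<close> covers both cases: it is 1 for
    \<open>N = 0\<close> and 0 otherwise.\<close>
  have f0: "f 0 = c 0 * 0 ^ N"
  proof -
    have "(\<lambda>k. c k * 0 ^ (N + k)) sums (c 0 * 0 ^ N)"
    proof -
      have "(\<lambda>k. c k * 0 ^ (N + k)) = (\<lambda>k. if k = 0 then c k * 0 ^ N else 0)"
        by (auto simp: fun_eq_iff)
      then show ?thesis using sums_single[of 0 "\<lambda>k. c k * 0 ^ N"] by simp
    qed
    then show ?thesis using sums[of 0] s sums_unique2 by auto
  qed
  have fg: "f x = x ^ N * g x" for x
    using f0 by (simp add: g_def)
  have g_sums: "(\<lambda>k. c k * x ^ k) sums g x" if "norm x < \<rho>" for x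
  proof (cases "x = 0")
    case True
    then show ?thesis using powser_sums_zero[of c] by (simp add: g_def)
  next
    case False
    have "(\<lambda>k. c k * x ^ (N + k) / x ^ N) sums (f x / x ^ N)"
      using sums[OF that] by (rule sums_divide)
    with False show ?thesis by (simp add: g_def power_add)
  qed
  have g_holo: "g holomorphic_on ball 0 \<rho>"
    using g_sums by (intro power_series_holomorphic[of 0 \<rho> c]) auto
  have "norm (g x) \<le> B / s ^ N"
  proof (rule maximum_modulus_frontier[of g "cball 0 s"])
    show "g holomorphic_on interior (cball 0 s)"
      by (rule holomorphic_on_subset[OF g_holo]) (use s in auto)
    show "continuous_on (closure (cball 0 s)) g"
      by (rule continuous_on_subset[OF holomorphic_on_imp_continuous_on[OF g_holo]]) (use s in auto)
    show "norm (g z) \<le> B / s ^ N" if "z \<in> frontier (cball 0 s)" for z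
      using that s bound[of z] fg[of z] by (simp add: norm_mult norm_power field_simps)
  qed (use x in auto)
  then have "norm x ^ N * norm (g x) \<le> norm x ^ N * (B / s ^ N)"
    by (intro mult_left_mono) auto
  then show ?thesis by (simp add: fg[of x] norm_mult norm_power mult_ac)
qed

text \<open>Meant for the second coordinate, which contracts by \<open>norm \<mu>\<close> up to an
  error proportional to \<open>norm x\<close>. Once the error is small, the iteration draws
  \<open>b\<close> towards a small fixed point.\<close>

lemma tendsto_zero_linear_recurrence:
  fixes b e :: "nat \<Rightarrow> real"
  assumes nonneg: "\<And>n. b n \<ge> 0" and rec: "\<And>n. b (Suc n) \<le> \<kappa> * b n + e n"
    and \<kappa>: "0 \<le> \<kappa>" "\<kappa> < 1" and e: "e \<longlonglongrightarrow> 0"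
  shows "b \<longlonglongrightarrow> 0"
proof (rule LIMSEQ_I)
  fix \<epsilon> :: real assume "\<epsilon> > 0"
  define \<eta> where "\<eta> = \<epsilon> / 2"
  have \<eta>: "\<eta> > 0" using \<open>\<epsilon> > 0\<close> by (simp add: \<eta>_def)
  \<comment> \<open>The threshold makes \<eta> the fixed point of the map sending \<open>b\<close>
    to \<open>\<kappa> * b + (1 - \<kappa>) * \<eta>\<close>.\<close>
  have "\<forall>\<^sub>F n in sequentially. e n < (1 - \<kappa>) * \<eta>"
    using e \<kappa> \<eta> by (intro order_tendstoD(2)) auto
  then obtain N where N: "e n < (1 - \<kappa>) * \<eta>" if "n \<ge> N" for n
    by (auto simp: eventually_sequentially)
  have le: "b (N + k) \<le> \<kappa> ^ k * b N + \<eta>" for k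
  proof (induction k)
    case (Suc k)
    have "b (N + Suc k) \<le> \<kappa> * b (N + k) + (1 - \<kappa>) * \<eta>"
      using rec[of "N + k"] N[of "N + k"] by simp
    also have "\<dots> \<le> \<kappa> * (\<kappa> ^ k * b N + \<eta>) + (1 - \<kappa>) * \<eta>"
      using Suc \<kappa> by (intro add_right_mono mult_left_mono) auto
    finally show ?case by (simp add: algebra_simps)
  qed (use \<eta> in simp)
  have "(\<lambda>k. \<kappa> ^ k * b N) \<longlonglongrightarrow> 0"
    using \<kappa> by (intro tendsto_mult_left_zero LIMSEQ_realpow_zero) auto
  then have "\<forall>\<^sub>F k in sequentially. \<kappa> ^ k * b N < \<eta>"
    using \<eta> by (intro order_tendstoD(2)) auto
  then obtain K where K: "\<kappa> ^ k * b N < \<eta>" if "k \<ge> K" for k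
    by (auto simp: eventually_sequentially)
  have "b n < \<epsilon>" if "n \<ge> N + K" for n
    using le[of "n - N"] K[of "n - N"] that unfolding \<eta>_def by fastforce
  then show "\<exists>no. \<forall>n\<ge>no. norm (b n - 0) < \<epsilon>"
    using nonneg by auto
qed

section \<open>The set \<open>Delta m R\<close> in the coordinate \<open>- 1 / x ^ m\<close>\<close>

text \<open>Expanding the squares cancels \<open>1 / (2 * R\<^sup>2)\<close>. Division by the
  squared modulus of \<open>x ^ m\<close> then produces the real and imaginary parts of
  \<open>- 1 / x ^ m\<close>.\<close>

lemma mem_Delta_iff:
  assumes "R > 0" "x \<noteq> 0"
  shows "x \<in> Delta m R \<longleftrightarrow> R < Re (- 1 / x ^ m) + \<bar>Im (- 1 / x ^ m)\<bar>"
proof -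
  define u v N where "u = Re (x ^ m)" and "v = \<bar>Im (x ^ m)\<bar>" and "N = (norm (x ^ m))\<^sup>2"
  have N: "N > 0" "N = u\<^sup>2 + v\<^sup>2"
    using assms by (simp add: N_def) (simp add: N_def u_def v_def cmod_power2)
  have "x \<in> Delta m R \<longleftrightarrow> (u + 1 / (2 * R))\<^sup>2 + (v - 1 / (2 * R))\<^sup>2 < 1 / (2 * R\<^sup>2)"
    by (simp add: Delta_def u_def v_def)
  also have "(u + 1 / (2 * R))\<^sup>2 + (v - 1 / (2 * R))\<^sup>2 = N + (u - v) / R + 1 / (2 * R\<^sup>2)"
    unfolding N(2) using assms by (simp add: power2_eq_square field_simps)
  also have "\<dots> < 1 / (2 * R\<^sup>2) \<longleftrightarrow> N + (u - v) / R < 0"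
    by linarith
  also have "\<dots> \<longleftrightarrow> R < (- u + v) / N"
    using assms N(1) by (simp add: field_simps)
  also have "(- u + v) / N = Re (- 1 / x ^ m) + \<bar>Im (- 1 / x ^ m)\<bar>"
    using assms N(1) by (simp add: Re_divide Im_divide u_def v_def N_def cmod_power2
        add_divide_distrib diff_divide_distrib)
  finally show ?thesis .
qed

lemma zero_notin_Delta: "m \<ge> 1 \<Longrightarrow> 0 \<notin> Delta m R"
  by (simp add: Delta_def power_divide power2_eq_square power_0_left)

lemma open_Delta: "open (Delta m R)"
  unfolding Delta_def by (intro open_Collect_less continuous_intros)

lemma closure_Delta_le:
  assumes R: "R > 0" and x: "x \<in> closure (Delta m R)" "x \<noteq> 0"
  shows "R \<le> Re (- 1 / x ^ m) + \<bar>Im (- 1 / x ^ m)\<bar>"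
proof -
  obtain s where s: "\<And>n. s n \<in> Delta m R" "s \<longlonglongrightarrow> x"
    using x(1) unfolding closure_sequential by blast
  have "\<forall>\<^sub>F n in sequentially. s n \<noteq> 0"
    using tendsto_imp_eventually_ne[OF s(2) x(2)] .
  then have "\<forall>\<^sub>F n in sequentially. R \<le> Re (- 1 / s n ^ m) + \<bar>Im (- 1 / s n ^ m)\<bar>"
    by eventually_elim (use s(1) mem_Delta_iff[OF R] in \<open>auto intro: less_imp_le\<close>)
  moreover have "(\<lambda>n. Re (- 1 / s n ^ m) + \<bar>Im (- 1 / s n ^ m)\<bar>)
      \<longlonglongrightarrow> Re (- 1 / x ^ m) + \<bar>Im (- 1 / x ^ m)\<bar>"
    by (intro tendsto_intros s(2)) (use x in auto)
  ultimately show ?thesis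
    by (intro tendsto_lowerbound) auto
qed

text \<open>The petals shrink to the origin as \<open>R\<close> grows, so every smallness condition
  on \<open>x\<close> can be met by choosing \<open>R\<close> large.\<close>

lemma closure_Delta_norm_le:
  assumes R: "R > 0" and m: "m \<ge> 1" and x: "x \<in> closure (Delta m R)"
  shows "norm x ^ m \<le> 2 / R"
proof (cases "x = 0")
  case True
  then show ?thesis using m R by (simp add: power_0_left)
next
  case False
  have "R \<le> 2 * norm (- 1 / x ^ m)"
    using closure_Delta_le[OF R x False] abs_Re_le_cmod[of "- 1 / x ^ m"]
      abs_Im_le_cmod[of "- 1 / x ^ m"] by linarith
  also have "\<dots> = 2 / norm x ^ m" by (simp add: norm_divide norm_power)
  finally show ?thesis using False R by (simp add: field_simps)
qed

lemma Delta_mult_root_of_unity: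
  assumes "\<zeta> ^ m = 1"
  shows "\<zeta> * x \<in> Delta m R \<longleftrightarrow> x \<in> Delta m R"
  by (simp add: Delta_def power_mult_distrib assms)

section \<open>The translation by \<open>m\<close> in the coordinate \<open>- 1 / w\<close>\<close>

text \<open>Here \<open>w\<close> stands for \<open>x ^ m\<close>, and
  \<open>1 + (w + w\<^sup>2 * G)\<close> for the factor by which \<open>x\<close> is multiplied,
  apart from \<open>lam\<close>. Since the derivative of \<open>1 - inverse ((1 + s) ^ m)\<close> at
  0 is \<open>m\<close>, the increment of \<open>- 1 / w\<close> is \<open>m\<close> up to an error
  that tends to 0 with \<open>w\<close>, uniformly for \<open>norm G \<le> K\<close>.\<close>

lemma inverse_power_step_estimate:
  fixes K \<epsilon> :: real
  assumes m: "m \<ge> 1" and \<epsilon>: "\<epsilon> > 0"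
  shows "\<exists>\<delta>>0. \<forall>w G :: complex. 0 < norm w \<longrightarrow> norm w < \<delta> \<longrightarrow> norm G \<le> K \<longrightarrow>
    norm (w + w\<^sup>2 * G) < \<epsilon> \<and>
    norm (- 1 / (w * (1 + (w + w\<^sup>2 * G)) ^ m) - (- 1 / w) - of_nat m) < 1 / 2"
proof -
  define f where "f s = 1 - inverse ((1 + s) ^ m)" for s :: complex
  have "(f has_field_derivative of_nat m) (at 0)"
    unfolding f_def by (auto intro!: derivative_eq_intros)
  then have "(f has_derivative (\<lambda>s. of_nat m * s)) (at 0)"
    by (simp add: has_field_derivative_def)
  \<comment> \<open>The factor 1/8 suffices because \<open>norm s \<le> 2 * norm w\<close> below:
    after division by \<open>w\<close> this error is at most 1/4.\<close>
  then obtain d where d: "d > 0"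
    and df: "\<And>s. norm s < d \<Longrightarrow> norm (f s - of_nat m * s) \<le> 1 / 8 * norm s"
  proof -
    have "\<exists>d>0. \<forall>s. norm (s - 0) < d \<longrightarrow> norm (f s - f 0 - of_nat m * (s - 0)) \<le> 1 / 8 * norm (s - 0)"
      using \<open>(f has_derivative _) _\<close> unfolding has_derivative_at_alt
      by (metis zero_less_divide_1_iff zero_less_numeral)
    then show ?thesis using that by (auto simp: f_def)
  qed
  define L where "L = max K 1"
  have L: "L \<ge> 1" "L \<ge> K" by (auto simp: L_def)
  \<comment> \<open>The first two bounds put \<open>s\<close> within \<open>d\<close> and \<epsilon>
    of 0; the third makes the error from \<open>s - w\<close>, at most
    \<open>norm w * (real m * L)\<close>, less than 1/4.\<close>
  define \<delta> where "\<delta> = min (min (d / 2) (\<epsilon> / 2)) (1 / (4 * real m * L))"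
  have mL: "real m * L > 0" "4 * (real m * L) \<ge> L" using m L by auto
  have \<delta>0: "\<delta> > 0" using d \<epsilon> m L by (simp add: \<delta>_def)
  have "norm (w + w\<^sup>2 * G) < \<epsilon> \<and>
    norm (- 1 / (w * (1 + (w + w\<^sup>2 * G)) ^ m) - (- 1 / w) - of_nat m) < 1 / 2"
    if w: "0 < norm w" "norm w < \<delta>" and G: "norm G \<le> K" for w G :: complex
  proof -
    define s where "s = w + w\<^sup>2 * G"
    have w\<delta>: "2 * norm w < d" "2 * norm w < \<epsilon>" "norm w * (4 * real m * L) < 1"
      using w(2) mL by (auto simp: \<delta>_def field_simps)
    have sw: "norm (s - w) \<le> norm w * (norm w * L)"
    proof -
      have "norm (s - w) = norm w * (norm w * norm G)"
        by (simp add: s_def norm_mult norm_power power2_eq_square)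
      also have "\<dots> \<le> norm w * (norm w * L)" using G L by (intro mult_left_mono) auto
      finally show ?thesis .
    qed
    have "norm w * L \<le> norm w * (4 * real m * L)" using mL by (intro mult_left_mono) auto
    then have "norm w * L < 1" using w\<delta> by linarith
    then have "norm (s - w) \<le> norm w"
      using sw w(1) by (meson less_imp_le mult_left_le norm_ge_zero order_trans)
    then have s2: "norm s \<le> 2 * norm w"
      using norm_triangle_ineq2[of s w] by linarith
    have w0: "w \<noteq> 0" using w by auto
    have "- 1 / (w * (1 + s) ^ m) - (- 1 / w) = f s / w"
      unfolding f_def using w0 by (simp add: field_simps)
    also have "f s / w - of_nat m = (f s - of_nat m * s) / w + of_nat m * (s - w) / w"
      using w0 by (simp add: field_simps)
    also have "norm \<dots> \<le> norm (f s - of_nat m * s) / norm w + real m * norm (s - w) / norm w"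
      by (rule order_trans[OF norm_triangle_ineq]) (simp add: norm_divide norm_mult)
    also have "\<dots> \<le> (1 / 8 * (2 * norm w)) / norm w + real m * (norm w * (norm w * L)) / norm w"
      using df[of s] s2 w\<delta> sw w(1)
      by (intro add_mono divide_right_mono mult_left_mono) auto
    also have "\<dots> = 1 / 4 + norm w * (real m * L)" using w0 by simp
    also have "\<dots> < 1 / 2" using w\<delta>(3) by (simp add: mult_ac)
    finally show ?thesis using s2 w\<delta> by (simp add: s_def)
  qed
  with \<delta>0 show ?thesis by blast
qed

section \<open>The axis of a petal as a locally constant invariant\<close>

text \<open>On \<open>Delta m R\<close> this is the \<open>m\<close>-th root of \<open>-1\<close> on the axis of the component of \<open>x\<close>.\<close>

definition petal_axis :: "nat \<Rightarrow> complex \<Rightarrow> complex"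
  where "petal_axis m x = x / exp (Ln (- (x ^ m)) / of_nat m)"

lemma petal_axis_power:
  assumes "m \<ge> 1" "x \<noteq> 0"
  shows "petal_axis m x ^ m = -1"
proof -
  have "exp (Ln (- (x ^ m)) / of_nat m) ^ m = exp (of_nat m * (Ln (- (x ^ m)) / of_nat m))"
    by (rule exp_of_nat_mult[symmetric])
  also have "of_nat m * (Ln (- (x ^ m)) / of_nat m) = Ln (- (x ^ m))" using assms by simp
  also have "exp \<dots> = - (x ^ m)" using assms by (intro exp_Ln) simp
  finally show ?thesis using assms by (simp add: petal_axis_def power_divide)
qed

lemma petal_axis_mult_root_of_unity:
  assumes "\<zeta> ^ m = 1"
  shows "petal_axis m (\<zeta> * x) = \<zeta> * petal_axis m x"
  by (simp add: petal_axis_def power_mult_distrib assms)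

text \<open>In the sector with number \<open>k\<close> the point \<open>- (x ^ m)\<close> has
  argument \<open>real m * \<theta> - (2 * of_int k + 1) * pi\<close>, which lies in the principal
  range. Dividing \<open>x\<close> by the principal root of \<open>- (x ^ m)\<close> therefore
  leaves the direction of the bisector.\<close>

lemma petal_axis_cis:
  assumes m: "m \<ge> 1" and t: "t > 0"
    and \<theta>: "2 * pi * of_int k < real m * \<theta>" "real m * \<theta> < 2 * pi * of_int (k + 1)"
  shows "petal_axis m (of_real t * cis \<theta>) = cis ((2 * of_int k + 1) * pi / real m)"
proof -
  define x where "x = of_real t * cis \<theta>"
  define b where "b = Complex (real m * ln t) (real m * \<theta> - (2 * of_int k + 1) * pi)"
  have "Ln (- (x ^ m)) = b"
  proof (rule Ln_unique)
    have "exp b = of_real (t ^ m) * cis (real m * \<theta> - (2 * of_int k + 1) * pi)"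
      using t by (subst exp_eq_polar) (simp add: b_def exp_of_nat_mult)
    also have "cis (real m * \<theta> - (2 * of_int k + 1) * pi) = - cis (real m * \<theta>)"
    proof -
      have "cis ((2 * of_int k + 1) * pi) = cis (2 * pi * of_int k) * cis pi"
        by (subst cis_mult) (simp add: algebra_simps)
      also have "\<dots> = -1" by (simp add: cis_multiple_2pi)
      finally show ?thesis by (simp add: cis_divide[symmetric])
    qed
    finally show "exp b = - (x ^ m)"
      unfolding x_def power_mult_distrib Complex.DeMoivre by simp
    show "- pi < Im b" "Im b \<le> pi" using \<theta> by (simp_all add: b_def algebra_simps)
  qed
  moreover have "x = exp (b / of_nat m) * cis ((2 * of_int k + 1) * pi / real m)"
  proof -
    have "exp (b / of_nat m) = of_real t * cis ((real m * \<theta> - (2 * of_int k + 1) * pi) / real m)"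
      using t m by (subst exp_eq_polar) (simp add: b_def)
    then show ?thesis
      using m by (simp add: x_def cis_mult diff_divide_distrib flip: mult.assoc)
  qed
  ultimately show ?thesis
    unfolding petal_axis_def x_def[symmetric] by simp
qed

text \<open>The argument of \<open>- (x ^ m)\<close> thus has modulus below
  \<open>3 * pi / 4\<close>. This gives continuity of \<open>petal_axis\<close>, and leaves room
  \<open>pi / 4\<close> before the branch cut of \<open>Ln\<close> for small rotations.\<close>

lemma Delta_uminus_power:
  assumes R: "R > 0" and x: "x \<in> Delta m R"
  shows "\<bar>Im (- (x ^ m))\<bar> > - Re (- (x ^ m))"
proof -
  define u v h where "u = Re (x ^ m)" and "v = \<bar>Im (x ^ m)\<bar>" and "h = 1 / (2 * R)"
  have "(u + h)\<^sup>2 + (v - h)\<^sup>2 < 2 * h\<^sup>2"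
    using x by (simp add: Delta_def u_def v_def h_def power_divide power_mult_distrib)
  then have "u\<^sup>2 + v\<^sup>2 < 2 * h * (v - u)"
    by (simp add: power2_eq_square algebra_simps)
  then have "0 < 2 * h * (v - u)"
    by (meson le_less_trans sum_power2_ge_zero)
  moreover have "0 < h" using R by (simp add: h_def)
  ultimately show ?thesis by (simp add: zero_less_mult_iff u_def v_def)
qed

lemma Delta_uminus_power_notin_nonpos:
  assumes "R > 0" "x \<in> Delta m R"
  shows "- (x ^ m) \<notin> \<real>\<^sub>\<le>\<^sub>0"
  using Delta_uminus_power[OF assms] by (auto simp: complex_nonpos_Reals_iff)

lemma continuous_on_petal_axis:
  assumes "R > 0"
  shows "continuous_on (Delta m R) (petal_axis m)"
  unfolding petal_axis_def
  using Delta_uminus_power_notin_nonpos[OF assms]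
  \<comment> \<open>For \<open>m = 0\<close> division by zero makes the exponent 0, and
    \<open>petal_axis\<close> is the identity.\<close>
  by (cases "m = 0") (auto intro!: continuous_intros)

text \<open>The argument of \<open>- (x ^ m)\<close> is below \<open>3 * pi / 4\<close> in modulus
  and \<open>u ^ m\<close> turns it by less than \<open>pi / 4\<close>. The branch cut is not
  crossed, so the logarithms add and the factor \<open>u\<close> cancels.\<close>

lemma petal_axis_mult_near_1:
  assumes m: "m \<ge> 1" and R: "R > 0" and x: "x \<in> Delta m R"
    and u: "u \<noteq> 0" "real m * \<bar>Im (Ln u)\<bar> < pi / 4"
  shows "petal_axis m (x * u) = petal_axis m x"
proof -
  define v where "v = - (x ^ m)"
  define A where "A = Im (Ln v)"
  have x0: "x \<noteq> 0" using x zero_notin_Delta[OF m] by auto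
  have v0: "v \<noteq> 0" using x0 by (simp add: v_def)
  have v: "\<bar>Im v\<bar> > - Re v" using Delta_uminus_power[OF R x] by (simp add: v_def)
  have A: "- pi < A" "A \<le> pi"
    using mpi_less_Im_Ln[OF v0] Im_Ln_le_pi[OF v0] by (auto simp: A_def)
  have veq: "v = of_real (norm v) * cis A"
    using v0 by (metis A_def exp_Ln exp_eq_polar norm_exp_eq_Re)
  have ReIm: "Re v = norm v * cos A" "\<bar>Im v\<bar> = norm v * \<bar>sin A\<bar>"
    by (subst veq, simp add: abs_mult)+
  have "norm v * (- cos A) < norm v * \<bar>sin A\<bar>"
    using v unfolding ReIm by simp
  then have cs: "- cos A < \<bar>sin A\<bar>"
    using v0 by (metis mult_less_cancel_left_pos zero_less_norm_iff)
  have "A \<noteq> pi" using cs by auto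
  \<comment> \<open>The shift by \<open>pi\<close> flips the signs of sine and cosine, which brings
    \<open>cs\<close> into the form of \<open>abs_sin_gt_cos_iff\<close>.\<close>
  then have "0 < A + pi" "A + pi < 2 * pi" using A by auto
  from abs_sin_gt_cos_iff[OF this] cs have "pi / 4 < A + pi" "A + pi < 7 * pi / 4"
    by simp_all
  then have "\<bar>A\<bar> < 3 * pi / 4" by linarith
  moreover have "\<bar>real m * Im (Ln u)\<bar> < pi / 4" using u by (simp add: abs_mult)
  ultimately have Im: "\<bar>A + real m * Im (Ln u)\<bar> < pi" by linarith
  have "Ln (- ((x * u) ^ m)) = Ln v + of_nat m * Ln u"
  proof (rule Ln_unique)
    show "exp (Ln v + of_nat m * Ln u) = - ((x * u) ^ m)"
      using v0 u(1) by (simp add: exp_add exp_of_nat_mult power_mult_distrib) (simp add: v_def)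
    show "- pi < Im (Ln v + of_nat m * Ln u)" "Im (Ln v + of_nat m * Ln u) \<le> pi"
      using Im by (auto simp: A_def abs_less_iff)
  qed
  then show ?thesis
    using u(1) m by (simp add: petal_axis_def v_def add_divide_distrib exp_add)
qed

text \<open>The image of a component is connected and lies among the finitely many roots of
  \<open>z ^ m = -1\<close>, hence is a single point.\<close>

lemma petal_axis_eq_on_component:
  assumes m: "m \<ge> 1" and R: "R > 0" and K: "K \<in> components (Delta m R)" "x \<in> K" "y \<in> K"
  shows "petal_axis m x = petal_axis m y"
proof -
  have sub: "K \<subseteq> Delta m R" using K(1) by (rule in_components_subset)
  have "connected (petal_axis m ` K)"
    using continuous_on_subset[OF continuous_on_petal_axis[OF R] sub]
      in_components_connected[OF K(1)]
    by (rule connected_continuous_image)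
  moreover have "petal_axis m ` K \<subseteq> {z. z ^ m = -1}"
    using petal_axis_power[OF m] zero_notin_Delta[OF m] sub
    by (metis (mono_tags, lifting) image_subsetI mem_Collect_eq subsetD)
  then have "finite (petal_axis m ` K)"
    using finite_nth_roots[of m "-1"] m by (auto intro: finite_subset)
  ultimately obtain a where "petal_axis m ` K = {a}"
    using K by (auto simp: connected_finite_iff_sing)
  then show ?thesis using K by (metis imageI singletonD)
qed

text \<open>There are as many components as roots of \<open>z ^ m = -1\<close>, so injectivity
  follows from surjectivity. All roots occur because rotations by roots of unity preserve
  \<open>Delta m R\<close> and rotate the axis along.\<close>

lemma inj_petal_axis_components:
  assumes m: "m \<ge> 1" and R: "R > 0" and card: "card (components (Delta m R)) = m"
    and C: "C \<in> components (Delta m R)" "x \<in> C" and y: "y \<in> Delta m R"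
    and eq: "petal_axis m x = petal_axis m y"
  shows "y \<in> C"
proof -
  define V where "V = {z::complex. z ^ m = -1}"
  have cardV: "card V = m" unfolding V_def using m by (intro card_nth_roots) auto
  have range: "petal_axis m z \<in> V" if "z \<in> Delta m R" for z
    using that petal_axis_power[OF m, of z] zero_notin_Delta[OF m] by (auto simp: V_def)
  define f where "f K = petal_axis m (SOME z. z \<in> K)" for K
  have f: "petal_axis m z = f K" if K: "K \<in> components (Delta m R)" and z: "z \<in> K" for K z
    unfolding f_def using petal_axis_eq_on_component[OF m R K z] someI[of "\<lambda>z. z \<in> K", OF z] by blast
  have "f ` components (Delta m R) = V"
  proof (intro equalityI subsetI)
    fix v assume "v \<in> f ` components (Delta m R)"
    then obtain K where K: "K \<in> components (Delta m R)" "v = f K" by blast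
    moreover obtain z where "z \<in> K" using in_components_nonempty[OF K(1)] by blast
    ultimately show "v \<in> V" using f range in_components_subset by (metis subsetD)
  next
    fix v assume "v \<in> V"
    have xD: "x \<in> Delta m R" using C in_components_subset by blast
    \<comment> \<open>This rotation carries the axis of \<open>x\<close> to
      \<open>v\<close>.\<close>
    define \<zeta> where "\<zeta> = v / petal_axis m x"
    have \<zeta>: "\<zeta> ^ m = 1" using \<open>v \<in> V\<close> range[OF xD] by (simp add: \<zeta>_def V_def power_divide)
    have "petal_axis m x \<noteq> 0" using range[OF xD] m by (auto simp: V_def power_0_left)
    then have "petal_axis m (\<zeta> * x) = v"
      unfolding petal_axis_mult_root_of_unity[OF \<zeta>] by (simp add: \<zeta>_def)
    moreover have "\<zeta> * x \<in> Delta m R" using Delta_mult_root_of_unity[OF \<zeta>] xD by simp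
    then obtain K where "K \<in> components (Delta m R)" "\<zeta> * x \<in> K"
      using Union_components by blast
    ultimately show "v \<in> f ` components (Delta m R)" using f by blast
  qed
  then have "inj_on f (components (Delta m R))"
    using card cardV m by (intro eq_card_imp_inj_on card_ge_0_finite) auto
  moreover obtain K where K: "K \<in> components (Delta m R)" "y \<in> K"
    using y Union_components by blast
  ultimately have "K = C" using f[OF K] f[OF C] eq C(1) by (metis inj_onD)
  then show ?thesis using K by simp
qed

section \<open>From cyclic labels to axes\<close>

text \<open>Replaces the labelling by an explicit formula for the axis; \<open>k0\<close> reflects
  the free choice of the component with label 1. Sector numbers increase strictly with the label and
  by exactly \<open>m\<close> over \<open>m\<close> labels, so they increase by 1 each time.\<close>

lemma ccw_labelling_mem_iff:
  assumes m: "m \<ge> 1" and R: "R > 0" and L: "ccw_labelling m (Delta m R) D"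
  obtains k0 where "\<And>j x. x \<in> D j \<longleftrightarrow>
    x \<in> Delta m R \<and> petal_axis m x = cis ((2 * of_int (j + k0) + 1) * pi / real m)"
proof -
  have bij: "bij_betw D {1..int m} (components (Delta m R))"
    and per: "\<And>j. D (j + int m) = D j" using L by (auto simp: ccw_labelling_def)
  obtain \<theta> :: "int \<Rightarrow> real" where \<theta>: "strict_mono \<theta>" "\<And>j. \<theta> (j + int m) = \<theta> j + 2 * pi"
    "\<And>j. \<exists>t>0. of_real t * cis (\<theta> j) \<in> D j"
    using L by (auto simp: ccw_labelling_def)
  have card: "card (components (Delta m R)) = m"
    using bij_betw_same_card[OF bij] by simp
  have per': "D (j + int m * i) = D j" for i j
  proof (induction i rule: int_induct[where k = 0])
    case (step1 i)
    then show ?case using per[of "j + int m * i"] by (simp add: algebra_simps)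
  next
    case (step2 i)
    then show ?case using per[of "j + int m * (i - 1)"] by (simp add: algebra_simps)
  qed simp
  \<comment> \<open>Reduces an index modulo \<open>m\<close> into the range on which
    \<open>D\<close> is a bijection; the shift by 1 is there because this range starts at 1.\<close>
  define red where "red j = (j - 1) mod int m + 1" for j
  have red: "red j \<in> {1..int m}" "D (red j) = D j" for j
  proof -
    show "red j \<in> {1..int m}"
      using m pos_mod_bound[of "int m" "j - 1"] pos_mod_sign[of "int m" "j - 1"]
      unfolding red_def atLeastAtMost_iff by linarith
    have "red j + int m * ((j - 1) div int m) = j" by (simp add: red_def)
    with per'[of "red j" "(j - 1) div int m"] show "D (red j) = D j" by simp
  qed
  have comp: "D j \<in> components (Delta m R)" for j
    using bspec[OF bij_betwE[OF bij] red(1)[of j]] unfolding red(2) .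
  have inj: "j = j'" if "D j = D j'" "j \<le> j'" "j' < j + int m" for j j'
  proof -
    have "D (red j) = D (red j')" using red(2)[of j] red(2)[of j'] that(1) by metis
    then have "red j = red j'"
      by (rule inj_onD[OF bij_betw_imp_inj_on[OF bij] _ red(1) red(1)])
    then have "(j' - 1) mod int m = (j - 1) mod int m" by (simp add: red_def)
    then have "int m dvd (j' - 1) - (j - 1)" by (rule mod_eq_dvd_iff[THEN iffD1])
    then have "int m dvd j' - j" by (simp only: diff_diff_eq2 diff_add_cancel)
    moreover have "j' - j < int m" using that(3) by simp
    ultimately have "\<not> 0 < j' - j" using zdvd_not_zless by blast
    then show ?thesis using that(2) by linarith
  qed
  \<comment> \<open>The number of the sector of opening \<open>2 * pi / m\<close> that contains the
    angle \<open>\<theta> j\<close>.\<close>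
  define k where "k j = \<lfloor>real m * \<theta> j / (2 * pi)\<rfloor>" for j
  have axis: "petal_axis m x = cis ((2 * of_int (k j) + 1) * pi / real m)" if x: "x \<in> D j" for x j
  proof -
    obtain t where t: "t > 0" "of_real t * cis (\<theta> j) \<in> D j" using \<theta>(3) by blast
    have "of_int (k j) \<le> real m * \<theta> j / (2 * pi)" "real m * \<theta> j / (2 * pi) < of_int (k j + 1)"
      unfolding k_def by linarith+
    then have le: "2 * pi * of_int (k j) \<le> real m * \<theta> j" "real m * \<theta> j < 2 * pi * of_int (k j + 1)"
      by (simp_all add: field_simps)
    \<comment> \<open>On a boundary ray of a sector \<open>x ^ m\<close> would be positive, and no
      point of \<open>Delta m R\<close> has this property.\<close>
    have "2 * pi * of_int (k j) \<noteq> real m * \<theta> j"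
    proof
      assume "2 * pi * of_int (k j) = real m * \<theta> j"
      then have "cis (real m * \<theta> j) = 1"
        using cis_multiple_2pi[of "of_int (k j)"] by simp
      then have "(of_real t * cis (\<theta> j)) ^ m = of_real (t ^ m)"
        by (simp add: power_mult_distrib Complex.DeMoivre)
      moreover have "of_real t * cis (\<theta> j) \<in> Delta m R"
        using t(2) in_components_subset[OF comp] by blast
      ultimately show False
        using Delta_uminus_power[OF R] t(1) by fastforce
    qed
    then have "petal_axis m (of_real t * cis (\<theta> j)) = cis ((2 * of_int (k j) + 1) * pi / real m)"
      using le by (intro petal_axis_cis[OF m t(1)]) auto
    then show ?thesis using petal_axis_eq_on_component[OF m R comp x t(2)] by simp
  qed
  have k_per: "k (j + int m) = k j + int m" for j
  proof -
    have "real m * \<theta> (j + int m) / (2 * pi) = real m * \<theta> j / (2 * pi) + of_int (int m)"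
      by (simp add: \<theta>(2) field_simps)
    then show ?thesis unfolding k_def by (simp only: floor_add_int)
  qed
  have k_less: "k j < k (j + 1)" for j
  proof -
    have "\<theta> j < \<theta> (j + 1)" using \<theta>(1) by (auto simp: strict_mono_def)
    then have "k j \<le> k (j + 1)" unfolding k_def using m
      by (intro floor_mono divide_right_mono mult_left_mono) auto
    \<comment> \<open>Equal sector numbers give equal axes, hence \<open>D j = D (j + 1)\<close>.
      This forces \<open>m = 1\<close>, where \<open>k_per\<close> already gives an increase by
      1.\<close>
    moreover have "k j \<noteq> k (j + 1)"
    proof
      assume eq: "k j = k (j + 1)"
      obtain y z where y: "y \<in> D j" and z: "z \<in> D (j + 1)"
        using in_components_nonempty[OF comp] by blast
      have "z \<in> D j"
        using axis[OF y] axis[OF z] eq z in_components_subset[OF comp]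
        by (intro inj_petal_axis_components[OF m R card comp y]) auto
      then have "D j = D (j + 1)"
        using components_eq[OF comp comp] z by blast
      then have "\<not> 1 < m" using inj[of j "j + 1"] by auto
      with m have "m = 1" by linarith
      then show False using k_per[of j] eq by simp
    qed
    ultimately show ?thesis by simp
  qed
  have k_ge: "k (j + int n) \<ge> k j + int n" for j n
  proof (induction n)
    case (Suc n)
    then show ?case using k_less[of "j + int n"] by (simp add: algebra_simps)
  qed simp
  \<comment> \<open>The remaining \<open>m - 1\<close> steps up to \<open>j + m\<close> gain at
    least \<open>m - 1\<close> of the total \<open>m\<close>, which leaves at most 1 for the first
    step.\<close>
  have k_Suc: "k (j + 1) = k j + 1" for j
    using k_ge[of "j + 1" "m - 1"] k_per[of j] k_less[of j] m by (simp add: algebra_simps of_nat_diff)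
  have k: "k j = j + k 0" for j
  proof (induction j rule: int_induct[where k = 0])
    case (step1 i)
    then show ?case using k_Suc[of i] by simp
  next
    case (step2 i)
    then show ?case using k_Suc[of "i - 1"] by simp
  qed simp
  show thesis
  proof (rule that[of "k 0"])
    fix j x
    obtain z where z: "z \<in> D j" using in_components_nonempty[OF comp] by blast
    define c where "c = cis ((2 * of_int (j + k 0) + 1) * pi / real m)"
    have axis': "petal_axis m x = c" if "x \<in> D j" for x
      using axis[OF that] by (simp only: k[of j] c_def)
    have "x \<in> D j" if "x \<in> Delta m R" "petal_axis m x = c"
      using that axis'[OF z] by (intro inj_petal_axis_components[OF m R card comp z]) simp_all
    then have "x \<in> D j \<longleftrightarrow> x \<in> Delta m R \<and> petal_axis m x = c"
      using axis' in_components_subset[OF comp] by blast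
    then show "x \<in> D j \<longleftrightarrow>
      x \<in> Delta m R \<and> petal_axis m x = cis ((2 * of_int (j + k 0) + 1) * pi / real m)"
      by (simp only: c_def)
  qed
qed

section \<open>One step of the map in the first coordinate\<close>

text \<open>As \<open>lam ^ m = 1\<close>, the step is \<open>Z + of_nat m + E\<close> with
  \<open>norm E < 1 / 2\<close>. The real part gains more than 1/2 and the modulus of the imaginary
  part loses less than 1/2, so their sum grows strictly and the closure is sent into the open
  set.\<close>

lemma Delta_step:
  assumes m: "m \<ge> 1" and R: "R > 0" and lam: "lam ^ m = 1"
    and x: "x \<in> closure (Delta m R)" "x \<noteq> 0" and u: "u \<noteq> 0"
    and est: "norm (- 1 / (x ^ m * u ^ m) - (- 1 / x ^ m) - of_nat m) < 1 / 2"
  shows "lam * (x * u) \<in> Delta m R"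
    and "Re (- 1 / (lam * (x * u)) ^ m) \<ge> Re (- 1 / x ^ m) + 1 / 2"
proof -
  define Z E where "Z = - 1 / x ^ m" and "E = - 1 / (x ^ m * u ^ m) - Z - of_nat m"
  have lam0: "lam \<noteq> 0" using lam m by (auto simp: power_0_left)
  have Z1: "- 1 / (lam * (x * u)) ^ m = Z + of_nat m + E"
    by (simp add: power_mult_distrib lam E_def)
  have "norm E < 1 / 2" using est by (simp add: E_def Z_def)
  then have E: "\<bar>Re E\<bar> < 1 / 2" "\<bar>Im E\<bar> < 1 / 2"
    using abs_Re_le_cmod[of E] abs_Im_le_cmod[of E] by linarith+
  have m1: "real m \<ge> 1" using m by simp
  show "Re (- 1 / (lam * (x * u)) ^ m) \<ge> Re (- 1 / x ^ m) + 1 / 2"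
    unfolding Z1 Z_def[symmetric] using E m1 by (simp add: abs_if split: if_splits)
  have "R \<le> Re Z + \<bar>Im Z\<bar>" using closure_Delta_le[OF R x] by (simp add: Z_def)
  then have "R < Re (Z + of_nat m + E) + \<bar>Im (Z + of_nat m + E)\<bar>"
    using E m1 by simp
  then show "lam * (x * u) \<in> Delta m R"
    using mem_Delta_iff[OF R, of "lam * (x * u)" m] lam0 x u unfolding Z1 by simp
qed

text \<open>The factor \<open>u\<close> preserves the axis, and \<open>lam\<close> turns it by
  \<open>i\<close> sectors, which adds \<open>i\<close> to the label.\<close>

lemma component_step:
  assumes m: "m \<ge> 1" and R: "R > 0" and L: "ccw_labelling m (Delta m R) D"
    and lam: "lam = cis (2 * pi * of_int i / real m)"
    and x: "x \<in> closure (D j)" and u: "u \<noteq> 0" "real m * \<bar>Im (Ln u)\<bar> < pi / 4"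
    and mem: "lam * (x * u) \<in> Delta m R"
  shows "lam * (x * u) \<in> D (j + i)"
proof -
  obtain k0 where k0: "x \<in> D j \<longleftrightarrow>
      x \<in> Delta m R \<and> petal_axis m x = cis ((2 * of_int (j + k0) + 1) * pi / real m)" for j x
    using ccw_labelling_mem_iff[OF m R L] by metis
  have "lam ^ m = cis (2 * pi * of_int i)"
    using m by (simp add: lam Complex.DeMoivre)
  then have lam1: "lam ^ m = 1" by (simp add: cis_multiple_2pi)
  have xu: "x * u \<in> Delta m R" using mem Delta_mult_root_of_unity[OF lam1] by simp
  \<comment> \<open>Since \<open>x\<close> may be a boundary point of \<open>D j\<close>, the axis
    of \<open>x * u\<close> is found as a limit from inside; \<open>x * u\<close> itself lies in the
    open set \<open>Delta m R\<close>, where \<open>petal_axis\<close> is continuous.\<close>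
  obtain s where s: "\<And>n. s n \<in> D j" "s \<longlonglongrightarrow> x"
    using x unfolding closure_sequential by blast
  have "isCont (petal_axis m) (x * u)"
    using continuous_on_petal_axis[OF R] open_Delta xu by (simp add: continuous_on_eq_continuous_at)
  then have "(\<lambda>n. petal_axis m (s n * u)) \<longlonglongrightarrow> petal_axis m (x * u)"
    by (rule isCont_tendsto_compose) (intro tendsto_intros s)
  moreover have "petal_axis m (s n * u) = cis ((2 * of_int (j + k0) + 1) * pi / real m)" for n
    using petal_axis_mult_near_1[OF m R _ u] s(1)[of n] unfolding k0 by simp
  ultimately have "petal_axis m (x * u) = cis ((2 * of_int (j + k0) + 1) * pi / real m)"
    by (simp add: LIMSEQ_const_iff)
  then have "petal_axis m (lam * (x * u)) = lam * cis ((2 * of_int (j + k0) + 1) * pi / real m)"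
    by (simp add: petal_axis_mult_root_of_unity[OF lam1])
  also have "\<dots> = cis ((2 * of_int (j + i + k0) + 1) * pi / real m)"
    by (simp add: lam cis_mult add_divide_distrib algebra_simps)
  finally show ?thesis using mem by (simp add: k0)
qed

section \<open>Uniform bounds from the normal form\<close>

lemma closure_petal_subset:
  "closure (petal r A) \<subseteq> closure A \<times> cball 0 r"
proof -
  have "petal r A = A \<times> ball 0 r" by (auto simp: petal_def)
  then show ?thesis
    using closure_minimal[of "ball 0 r" "cball (0::complex) r"] by (auto simp: closure_Times)
qed

text \<open>The map is bounded on a compact bidisk, so the series tail is bounded on the circle of
  radius \<open>s\<close>, uniformly in \<open>y\<close>. The tail estimate then gives it order
  \<open>2 * m + 2\<close> in \<open>x\<close>, and together with \<open>C\<close> it is absorbed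
  into the bounded factor \<open>G\<close>.\<close>

lemma semiparabolic_normal_form_bounds:
  fixes H :: "complex \<times> complex \<Rightarrow> complex \<times> complex" and a :: "nat \<Rightarrow> complex \<Rightarrow> complex"
  assumes s: "0 < s" "s < \<rho>" and lam: "lam \<noteq> 0"
    and cont: "continuous_on (bidisk \<rho>) (\<lambda>z. fst (H z))"
    and summable: "\<And>x y. (x, y) \<in> bidisk \<rho> \<Longrightarrow>
           summable (\<lambda>k. a (2 * m + 2 + k) y * x ^ (2 * m + 2 + k))"
    and H: "\<And>x y. (x, y) \<in> bidisk \<rho> \<Longrightarrow>
           fst (H (x, y)) = lam * (x + x ^ (m + 1) + C * x ^ (2 * m + 1)
             + (\<Sum>k. a (2 * m + 2 + k) y * x ^ (2 * m + 2 + k)))"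
  obtains K where "\<And>x y. x \<noteq> 0 \<Longrightarrow> norm x \<le> s \<Longrightarrow> norm y \<le> s \<Longrightarrow>
    \<exists>G. norm G \<le> K \<and> fst (H (x, y)) = lam * (x * (1 + (x ^ m + (x ^ m)\<^sup>2 * G)))"
proof -
  have sub: "cball 0 s \<times> cball 0 s \<subseteq> bidisk \<rho>" using s by (auto simp: bidisk_def)
  have "compact ((\<lambda>z. fst (H z)) ` (cball 0 s \<times> cball 0 s))"
    by (intro compact_continuous_image continuous_on_subset[OF cont sub] compact_Times) auto
  then obtain B where B: "\<And>x y. norm x \<le> s \<Longrightarrow> norm y \<le> s \<Longrightarrow> norm (fst (H (x, y))) \<le> B"
    by (force dest!: compact_imp_bounded simp: bounded_iff)
  define T where "T x y = (\<Sum>k. a (2 * m + 2 + k) y * x ^ (2 * m + 2 + k))" for x y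
  \<comment> \<open>Bound for the tail on the circle, obtained by solving the normal form for
    \<open>T\<close>.\<close>
  define B' where "B' = B / norm lam + s + s ^ (m + 1) + norm C * s ^ (2 * m + 1)"
  define K where "K = norm C + B' / s ^ (2 * m + 2) * s"
  have T: "norm (T x y) \<le> B' / s ^ (2 * m + 2) * norm x ^ (2 * m + 2)"
    if x: "norm x \<le> s" and y: "norm y \<le> s" for x y
  proof (rule norm_power_series_tail_le[OF s _ _ x])
    show "(\<lambda>k. a (2 * m + 2 + k) y * z ^ (2 * m + 2 + k)) sums T z y" if "norm z < \<rho>" for z :: complex
      unfolding T_def using that y s by (intro summable_sums summable) (auto simp: bidisk_def)
    fix z :: complex assume z: "norm z = s"
    have "(z, y) \<in> bidisk \<rho>" using z y s by (auto simp: bidisk_def)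
    from H[OF this] have "T z y = fst (H (z, y)) / lam - z - z ^ (m + 1) - C * z ^ (2 * m + 1)"
      using lam by (simp add: T_def field_simps)
    also have "norm \<dots> \<le> norm (fst (H (z, y)) / lam) + norm z + norm (z ^ (m + 1)) + norm (C * z ^ (2 * m + 1))"
      by (intro order_trans[OF norm_triangle_ineq4] add_right_mono order_refl)
    also have "\<dots> \<le> B'"
      using B[of z y] z y by (simp add: B'_def norm_mult norm_power norm_divide divide_right_mono)
    finally show "norm (T z y) \<le> B'" .
  qed
  \<comment> \<open>At \<open>x = s\<close> and \<open>y = 0\<close> the powers of \<open>s\<close>
    cancel in the bound \<open>T\<close>.\<close>
  have B'0: "0 \<le> B'"
    using T[of "of_real s" 0] s by (auto intro: order_trans[OF norm_ge_zero])
  show thesis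
  proof (rule that[of K])
    fix x y :: complex
    assume x: "x \<noteq> 0" "norm x \<le> s" and y: "norm y \<le> s"
    have "norm (T x y / x ^ (2 * m + 1)) \<le> B' / s ^ (2 * m + 2) * norm x ^ (2 * m + 2) / norm x ^ (2 * m + 1)"
      unfolding norm_divide norm_power using T[OF x(2) y] by (rule divide_right_mono) simp
    also have "\<dots> = B' / s ^ (2 * m + 2) * norm x" using x by simp
    also have "\<dots> \<le> B' / s ^ (2 * m + 2) * s" using x B'0 s by (intro mult_left_mono) auto
    finally have G: "norm (C + T x y / x ^ (2 * m + 1)) \<le> K"
      unfolding K_def by (intro order_trans[OF norm_triangle_ineq] add_left_mono)
    have xy: "(x, y) \<in> bidisk \<rho>" using x y s by (auto simp: bidisk_def)
    have "x ^ (m + 1) = x * x ^ m" "x ^ (2 * m + 1) = x * (x ^ m * x ^ m)"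
      by (simp_all add: mult_2 power_add)
    then have "fst (H (x, y)) =
        lam * (x * (1 + (x ^ m + (x ^ m)\<^sup>2 * (C + T x y / x ^ (2 * m + 1)))))"
      unfolding H[OF xy] T_def[symmetric] using x by (simp add: field_simps power2_eq_square)
    with G show "\<exists>G. norm G \<le> K \<and> fst (H (x, y)) = lam * (x * (1 + (x ^ m + (x ^ m)\<^sup>2 * G)))"
      by blast
  qed
qed

section \<open>Invariance of the petals and attraction to the origin\<close>

theorem proposition4p1:
  fixes H :: "complex \<times> complex \<Rightarrow> complex \<times> complex"
    and h :: "complex \<times> complex \<Rightarrow> complex"
    and a :: "nat \<Rightarrow> complex \<Rightarrow> complex"
    and C lam \<mu> :: complex
    and p :: int and q \<nu> m :: nat
    and \<rho> :: real
  assumes "q \<ge> 1" and "coprime p (int q)" and "\<nu> \<ge> 1"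
    and "m = \<nu> * q"
    and "lam = exp (2 * of_real pi * \<i> * of_int p / of_nat q)"
    and "norm \<mu> < 1"
    and "\<rho> > 0"
    and "holomorphic2_on (\<lambda>z. fst (H z)) (bidisk \<rho>)"
    and "holomorphic2_on (\<lambda>z. snd (H z)) (bidisk \<rho>)"
    and "\<And>n. n \<ge> 2 * m + 2 \<Longrightarrow> a n holomorphic_on ball 0 \<rho>"
    and "holomorphic2_on h (bidisk \<rho>)"
    and "\<And>x y. (x, y) \<in> bidisk \<rho> \<Longrightarrow>
           summable (\<lambda>k. a (2 * m + 2 + k) y * x ^ (2 * m + 2 + k))"
    and "\<And>x y. (x, y) \<in> bidisk \<rho> \<Longrightarrow>
           fst (H (x, y)) = lam * (x + x ^ (m + 1) + C * x ^ (2 * m + 1)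
             + (\<Sum>k. a (2 * m + 2 + k) y * x ^ (2 * m + 2 + k)))"
    and "\<And>x y. (x, y) \<in> bidisk \<rho> \<Longrightarrow> snd (H (x, y)) = \<mu> * y + x * h (x, y)"
  shows "\<forall>\<^sub>F r in at_right 0. \<forall>\<^sub>F R in at_top.
    closure (petal r (Delta m R)) \<subseteq> bidisk \<rho> \<and>
    (\<forall>D. ccw_labelling m (Delta m R) D \<longrightarrow>
       (\<forall>j\<in>{1..int (\<nu> * q)}.
          H ` closure (petal r (D j)) \<subseteq> petal r (D (j + int \<nu> * p)) \<union> {0} \<times> ball 0 r)) \<and>
    H ` closure (petal r (Delta m R)) \<subseteq> petal r (Delta m R) \<union> {0} \<times> ball 0 r \<and>
    (\<forall>z\<in>petal r (Delta m R). (\<lambda>n. (H ^^ n) z) \<longlonglongrightarrow> (0, 0))"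
proof -
  note q = assms(1) and \<nu> = assms(3) and meq = assms(4) and lam_eq = assms(5) and \<mu> = assms(6)
    and \<rho> = assms(7) and H_holo = assms(8) and h_holo = assms(11) and summable = assms(12)
    and H_fst = assms(13) and H_snd = assms(14)
  have m: "m \<ge> 1" using q \<nu> by (simp add: meq)
  \<comment> \<open>Written with denominator \<open>m\<close>, the fraction \<open>p / q\<close> has
    numerator \<open>i\<close>, so \<open>lam\<close> rotates by \<open>i\<close> sectors.\<close>
  define i where "i = int \<nu> * p"
  have lam: "lam = cis (2 * pi * of_int i / real m)"
    using q \<nu> unfolding lam_eq i_def meq cis_conv_exp by (simp add: field_simps)
  have "lam ^ m = cis (2 * pi * of_int i)" using m by (simp add: lam Complex.DeMoivre)
  then have lam1: "lam ^ m = 1" by (simp add: cis_multiple_2pi)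
  have lam0: "lam \<noteq> 0" by (simp add: lam)
  define s where "s = \<rho> / 2"
  have s: "0 < s" "s < \<rho>" using \<rho> by (auto simp: s_def)
  obtain K where K: "\<And>x y. x \<noteq> 0 \<Longrightarrow> norm x \<le> s \<Longrightarrow> norm y \<le> s \<Longrightarrow>
    \<exists>G. norm G \<le> K \<and> fst (H (x, y)) = lam * (x * (1 + (x ^ m + (x ^ m)\<^sup>2 * G)))"
    using semiparabolic_normal_form_bounds[OF s lam0
      holomorphic2_on_imp_continuous_on[OF H_holo] summable H_fst] by blast
  have "compact (h ` (cball 0 s \<times> cball 0 s))"
    using s by (intro compact_continuous_image compact_Times
        continuous_on_subset[OF holomorphic2_on_imp_continuous_on[OF h_holo]])
      (auto simp: bidisk_def)
  then obtain M where M: "M > 0" "\<And>x y. norm x \<le> s \<Longrightarrow> norm y \<le> s \<Longrightarrow> norm (h (x, y)) \<le> M"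
    by (force dest!: compact_imp_bounded simp: bounded_pos)
  have "isCont (\<lambda>v. real m * \<bar>Im (Ln (1 + v))\<bar>) 0"
    by (intro continuous_intros) auto
  then have "\<forall>\<^sub>F v in at 0. real m * \<bar>Im (Ln (1 + v))\<bar> < pi / 4"
    unfolding isCont_def by (rule order_tendstoD(2)) simp
  then obtain \<epsilon>0 where \<epsilon>0: "\<epsilon>0 > 0"
    "\<And>v. v \<noteq> 0 \<Longrightarrow> norm v < \<epsilon>0 \<Longrightarrow> real m * \<bar>Im (Ln (1 + v))\<bar> < pi / 4"
    unfolding eventually_at by auto
  \<comment> \<open>The bound 1 keeps \<open>1 + v\<close> away from 0; \<epsilon>0 keeps its
    rotation small enough to preserve the axis.\<close>
  define \<epsilon> where "\<epsilon> = min \<epsilon>0 1"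
  have \<epsilon>: "\<epsilon> > 0" using \<epsilon>0 by (simp add: \<epsilon>_def)
  have near_1: "1 + v \<noteq> 0" "real m * \<bar>Im (Ln (1 + v))\<bar> < pi / 4" if "norm v < \<epsilon>" for v
  proof -
    have "norm v < 1" using that by (simp add: \<epsilon>_def)
    then show "1 + v \<noteq> 0" by (metis add_eq_0_iff norm_minus_cancel norm_one less_irrefl)
    show "real m * \<bar>Im (Ln (1 + v))\<bar> < pi / 4"
      using \<epsilon>0(2)[of v] that by (cases "v = 0") (auto simp: \<epsilon>_def)
  qed
  obtain \<delta> where \<delta>: "\<delta> > 0" and est: "\<And>w G :: complex. 0 < norm w \<Longrightarrow> norm w < \<delta> \<Longrightarrow> norm G \<le> K \<Longrightarrow>
    norm (w + w\<^sup>2 * G) < \<epsilon> \<and>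
    norm (- 1 / (w * (1 + (w + w\<^sup>2 * G)) ^ m) - (- 1 / w) - of_nat m) < 1 / 2"
    using inverse_power_step_estimate[OF m \<epsilon>, of K] by blast
  \<comment> \<open>Bound on \<open>norm x\<close> chosen so that \<open>M * norm x\<close> is less
    than \<open>(1 - norm \<mu>) * r\<close>: the new second coordinate then stays strictly below
    \<open>r\<close>. Here the choice of \<open>R\<close> comes to depend on
    \<open>r\<close>.\<close>
  define t where "t r = min s ((1 - norm \<mu>) * r / M)" for r
  have main: "closure (petal r (Delta m R)) \<subseteq> bidisk \<rho> \<and>
    (\<forall>D. ccw_labelling m (Delta m R) D \<longrightarrow>
       (\<forall>j\<in>{1..int (\<nu> * q)}.
          H ` closure (petal r (D j)) \<subseteq> petal r (D (j + int \<nu> * p)) \<union> {0} \<times> ball 0 r)) \<and>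
    H ` closure (petal r (Delta m R)) \<subseteq> petal r (Delta m R) \<union> {0} \<times> ball 0 r \<and>
    (\<forall>z\<in>petal r (Delta m R). (\<lambda>n. (H ^^ n) z) \<longlonglongrightarrow> (0, 0))"
    if r: "0 < r" "r < s" and R: "0 < R" "2 / R < \<delta>" "2 / R < t r ^ m" for r R
  proof -
    have x_bounds: "norm x < s" "M * norm x < (1 - norm \<mu>) * r" "norm (x ^ m) < \<delta>"
      if x: "x \<in> closure (Delta m R)" for x
    proof -
      have *: "norm x ^ m \<le> 2 / R" using closure_Delta_norm_le[OF R(1) m x] .
      then have "norm x ^ m < t r ^ m" using R by linarith
      moreover have "0 \<le> t r" using s r \<mu> M by (simp add: t_def)
      ultimately have "norm x < t r" by (rule power_less_imp_less_base)
      then show "norm x < s" "M * norm x < (1 - norm \<mu>) * r"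
        using M by (simp_all add: t_def field_simps)
      show "norm (x ^ m) < \<delta>" using * R by (simp add: norm_power)
    qed
    have snd_H: "norm (snd (H (x, y))) \<le> norm \<mu> * norm y + M * norm x" "norm (snd (H (x, y))) < r"
      if x: "x \<in> closure (Delta m R)" and y: "norm y \<le> r" for x y
    proof -
      have "(x, y) \<in> bidisk \<rho>" using x_bounds[OF x] y s r by (auto simp: bidisk_def)
      then have "norm (snd (H (x, y))) \<le> norm (\<mu> * y) + norm (x * h (x, y))"
        by (simp add: H_snd norm_triangle_ineq)
      also have "\<dots> \<le> norm \<mu> * norm y + M * norm x"
        using M(2)[of x y] x_bounds[OF x] y r
        by (simp add: norm_mult mult.commute[of "norm x"] mult_right_mono)
      finally show *: "norm (snd (H (x, y))) \<le> norm \<mu> * norm y + M * norm x" .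
      also have "\<dots> < norm \<mu> * r + (1 - norm \<mu>) * r"
        using x_bounds[OF x] y by (intro add_le_less_mono mult_left_mono) auto
      finally show "norm (snd (H (x, y))) < r" by (simp add: algebra_simps)
    qed
    have fst_H: "\<exists>u. fst (H (x, y)) = lam * (x * u) \<and> u \<noteq> 0 \<and> real m * \<bar>Im (Ln u)\<bar> < pi / 4 \<and>
        lam * (x * u) \<in> Delta m R \<and> Re (- 1 / (lam * (x * u)) ^ m) \<ge> Re (- 1 / x ^ m) + 1 / 2"
      if x: "x \<in> closure (Delta m R)" "x \<noteq> 0" and y: "norm y \<le> r" for x y
    proof -
      have "norm x \<le> s" "norm y \<le> s" using x_bounds[OF x(1)] y r by auto
      from K[OF x(2) this] obtain G where G: "norm G \<le> K"
        "fst (H (x, y)) = lam * (x * (1 + (x ^ m + (x ^ m)\<^sup>2 * G)))" by blast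
      define u where "u = 1 + (x ^ m + (x ^ m)\<^sup>2 * G)"
      have e: "norm (x ^ m + (x ^ m)\<^sup>2 * G) < \<epsilon>"
        "norm (- 1 / (x ^ m * u ^ m) - (- 1 / x ^ m) - of_nat m) < 1 / 2"
        using est[of "x ^ m" G] x(2) x_bounds[OF x(1)] G(1) by (auto simp: u_def)
      have u: "u \<noteq> 0" "real m * \<bar>Im (Ln u)\<bar> < pi / 4"
        using near_1[OF e(1)] by (simp_all add: u_def)
      show ?thesis
        using Delta_step[OF m R(1) lam1 x u(1) e(2)] u G(2) by (auto simp: u_def)
    qed
    \<comment> \<open>Closures of petals may contain points with \<open>x = 0\<close>, where the
      coordinate \<open>- 1 / x ^ m\<close> fails; their images make up the exceptional part
      \<open>{0} \<times> ball 0 r\<close>.\<close>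
    have H_zero: "fst (H (0, y)) = 0" if "norm y \<le> r" for y
    proof -
      have "(0, y) \<in> bidisk \<rho>" using that s r by (auto simp: bidisk_def)
      then show ?thesis using H_fst[of 0 y] by simp
    qed
    have closure_bidisk: "closure (petal r (Delta m R)) \<subseteq> bidisk \<rho>"
      using closure_petal_subset[of r "Delta m R"] x_bounds s r by (fastforce simp: bidisk_def)
    have labelled: "H ` closure (petal r (D j)) \<subseteq> petal r (D (j + int \<nu> * p)) \<union> {0} \<times> ball 0 r"
      if L: "ccw_labelling m (Delta m R) D" for D j
    proof
      fix z assume "z \<in> H ` closure (petal r (D j))"
      then obtain x y where z: "z = H (x, y)" and x: "x \<in> closure (D j)" and y: "norm y \<le> r"
        using closure_petal_subset[of r "D j"] by auto
      have "D j \<subseteq> Delta m R"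
        by (rule ccw_labelling_mem_iff[OF m R(1) L]) auto
      then have x': "x \<in> closure (Delta m R)" using x closure_mono by blast
      show "z \<in> petal r (D (j + int \<nu> * p)) \<union> {0} \<times> ball 0 r"
      proof (cases "x = 0")
        case True
        then show ?thesis
          using H_zero[OF y] snd_H(2)[OF x' y] by (cases z) (auto simp: z)
      next
        case False
        obtain u where u: "fst (H (x, y)) = lam * (x * u)" "u \<noteq> 0" "real m * \<bar>Im (Ln u)\<bar> < pi / 4"
          "lam * (x * u) \<in> Delta m R"
          using fst_H[OF x' False y] by blast
        have "fst z \<in> D (j + i)"
          using component_step[OF m R(1) L lam x u(2-4)] by (simp add: z u(1))
        moreover have "norm (snd z) < r" using snd_H(2)[OF x' y] by (simp add: z)
        ultimately show ?thesis by (cases z) (simp add: petal_def i_def)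
      qed
    qed
    have step: "H z \<in> petal r (Delta m R)" "norm (snd (H z)) \<le> norm \<mu> * norm (snd z) + M * norm (fst z)"
      "Re (- 1 / fst (H z) ^ m) \<ge> Re (- 1 / fst z ^ m) + 1 / 2"
      if z: "fst z \<in> closure (Delta m R)" "fst z \<noteq> 0" "norm (snd z) \<le> r" for z
    proof -
      obtain x y where xy: "z = (x, y)" by (cases z)
      obtain u where u: "fst (H (x, y)) = lam * (x * u)"
          "lam * (x * u) \<in> Delta m R" "Re (- 1 / (lam * (x * u)) ^ m) \<ge> Re (- 1 / x ^ m) + 1 / 2"
        using fst_H[of x y] z unfolding xy by auto
      show "Re (- 1 / fst (H z) ^ m) \<ge> Re (- 1 / fst z ^ m) + 1 / 2"
        unfolding xy u(1) fst_conv by (rule u(3))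
      show "H z \<in> petal r (Delta m R)" "norm (snd (H z)) \<le> norm \<mu> * norm (snd z) + M * norm (fst z)"
        using snd_H[of x y] u(1,2) z unfolding xy by (auto simp: petal_def split_beta mem_Times_iff)
    qed
    have invariant: "H ` closure (petal r (Delta m R)) \<subseteq> petal r (Delta m R) \<union> {0} \<times> ball 0 r"
    proof
      fix z assume "z \<in> H ` closure (petal r (Delta m R))"
      then obtain x y where z: "z = H (x, y)" and x: "x \<in> closure (Delta m R)" and y: "norm y \<le> r"
        using closure_petal_subset[of r "Delta m R"] by auto
      show "z \<in> petal r (Delta m R) \<union> {0} \<times> ball 0 r"
      proof (cases "x = 0")
        case True
        then show ?thesis
          using H_zero[OF y] snd_H(2)[OF x y] by (cases z) (auto simp: z)
      next
        case False
        then show ?thesis using step(1)[of "(x, y)"] x y by (simp add: z)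
      qed
    qed
    have attracted: "(\<lambda>n. (H ^^ n) z) \<longlonglongrightarrow> (0, 0)" if z: "z \<in> petal r (Delta m R)" for z
    proof -
      define X Y where "X n = fst ((H ^^ n) z)" and "Y n = snd ((H ^^ n) z)" for n
      have orbit: "fst w \<in> closure (Delta m R)" "fst w \<noteq> 0" "norm (snd w) \<le> r"
        if "w \<in> petal r (Delta m R)" for w
        using that zero_notin_Delta[OF m, of R] closure_subset[of "Delta m R"]
        by (auto simp: petal_def)
      have mem: "(H ^^ n) z \<in> petal r (Delta m R)" for n
        by (induction n) (use z step(1) orbit in auto)
      have X0: "X n \<noteq> 0" for n using orbit(2)[OF mem] by (simp add: X_def)
      have Re_ge: "Re (- 1 / X n ^ m) \<ge> Re (- 1 / X 0 ^ m) + real n * (1 / 2)" for n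
      proof (induction n)
        case (Suc n)
        then show ?case
          using step(3)[OF orbit[OF mem[of n]]] by (simp add: X_def add_divide_distrib)
      qed simp
      \<comment> \<open>Linear growth of the real part forces the modulus of
        \<open>- 1 / X n ^ m\<close> to infinity, hence \<open>X n\<close> to 0.\<close>
      have "filterlim (\<lambda>n. Re (- 1 / X 0 ^ m) + real n * (1 / 2)) at_top sequentially"
        by (intro filterlim_tendsto_add_at_top[OF tendsto_const] filterlim_at_top_mult_tendsto_pos[OF tendsto_const])
          (auto intro: filterlim_real_sequentially)
      moreover have "Re (- 1 / X 0 ^ m) + real n * (1 / 2) \<le> inverse (norm (X n) ^ m)" for n
        using Re_ge[of n] complex_Re_le_cmod[of "- 1 / X n ^ m"]
        by (simp add: norm_divide norm_power inverse_eq_divide)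
      ultimately have "filterlim (\<lambda>n. inverse (norm (X n) ^ m)) at_top sequentially"
        by (rule filterlim_at_top_mono[OF _ always_eventually[OF allI]])
      then have "(\<lambda>n. inverse (inverse (norm (X n) ^ m))) \<longlonglongrightarrow> 0"
        by (rule tendsto_inverse_0_at_top)
      then have "(\<lambda>n. root m (norm (X n) ^ m)) \<longlonglongrightarrow> root m 0"
        by (intro tendsto_real_root) simp
      then have normX: "(\<lambda>n. norm (X n)) \<longlonglongrightarrow> 0"
        using m by (simp add: real_root_power_cancel)
      have "(\<lambda>n. norm (Y n)) \<longlonglongrightarrow> 0"
      proof (rule tendsto_zero_linear_recurrence)
        show "norm (Y (Suc n)) \<le> norm \<mu> * norm (Y n) + M * norm (X n)" for n
          using step(2)[OF orbit[OF mem[of n]]] by (simp add: X_def Y_def)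
        show "(\<lambda>n. M * norm (X n)) \<longlonglongrightarrow> 0"
          using normX by (rule tendsto_mult_right_zero)
      qed (use \<mu> in auto)
      then have "(\<lambda>n. (X n, Y n)) \<longlonglongrightarrow> (0, 0)"
        using normX by (intro tendsto_Pair) (auto simp: tendsto_norm_zero_iff)
      then show ?thesis by (simp add: X_def Y_def)
    qed
    show ?thesis using closure_bidisk labelled invariant attracted by blast
  qed
  show ?thesis
  proof (rule eventually_at_rightI[OF _ s(1)])
    fix r assume r: "r \<in> {0<..<s}"
    then have "t r ^ m > 0" using s \<mu> M by (simp add: t_def)
    have "\<forall>\<^sub>F R in at_top. 0 < R \<and> 2 / R < \<delta> \<and> 2 / R < t r ^ m"
      using eventually_gt_at_top[of 0] eventually_gt_at_top[of "2 / \<delta>"]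
        eventually_gt_at_top[of "2 / t r ^ m"]
      by eventually_elim (use \<delta> \<open>t r ^ m > 0\<close> in \<open>simp add: field_simps\<close>)
    then show "\<forall>\<^sub>F R in at_top.
      closure (petal r (Delta m R)) \<subseteq> bidisk \<rho> \<and>
      (\<forall>D. ccw_labelling m (Delta m R) D \<longrightarrow>
         (\<forall>j\<in>{1..int (\<nu> * q)}.
            H ` closure (petal r (D j)) \<subseteq> petal r (D (j + int \<nu> * p)) \<union> {0} \<times> ball 0 r)) \<and>
      H ` closure (petal r (Delta m R)) \<subseteq> petal r (Delta m R) \<union> {0} \<times> ball 0 r \<and>
      (\<forall>z\<in>petal r (Delta m R). (\<lambda>n. (H ^^ n) z) \<longlonglongrightarrow> (0, 0))"
      by eventually_elim (rule main, use r in auto)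
  qed
qed

end
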